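(* Let $\langle F,E\rangle$ be a weak-* sequentially complete anti-dual pair and let $A,B\in\mathscr L(E;F)$ be positive operators. The following are equivalent: (i) $B$ is absolutely continuous with respect to $A$; (ii) for every $y\in E$ there exists a sequence $(y_n)_{n\in\mathbb N}$ in $E$ such that $$\langle Bx,y\rangle=\lim_{n\to\infty}\langle Ax,y_n\rangle,\qquad x\in E,$$ and the convergence is uniform on the set $\{x\in E:\langle(A+B)x,x\rangle\le1\}$.
   Context: An anti-dual pair $\langle F,E\rangle$ consists of complex vector spaces $E,F$ and a map $\langle\cdot,\cdot\rangle:F\times E\to\mathbb C$, linear in the first and conjugate linear in the second variable, that separates the points of $E$ and of $F$. $\sigma(F,E)$ is the weak topology on $F$ induced by the functionals $\langle\cdot,x\rangle$ ($x\in E$), and $\sigma(E,F)$ is the weak topology on $E$ induced by the functionals $\langle f,\cdot\rangle$ ($f\in F$). The pair is weak-* sequentially complete if every Cauchy sequence of $(F,\sigma(F,E))$ converges. $\mathscr L(E;F)$ is the set of $\sigma(E,F)$-$\sigma(F,E)$ continuous linear operators $E\to F$. A linear operator $A:E\to F$ is positive if $\langle Ax,x\rangle\ge0$ for all $x\in E$. $B$ is absolutely continuous with respect to $A$ if for every sequence $(x_n)$ in $E$, $\langle Ax_n,x_n\rangle\to0$ and $\langle B(x_n-x_m),x_n-x_m\rangle\to0$ ($n,m\to\infty$) imply $\langle Bx_n,x_n\rangle\to0$. *)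

theory Defs
  imports "HOL-Analysis.Analysis" "HOL-Library.Complex_Order"
begin

text \<open>
  The spaces are the types \<open>'f\<close> and \<open>'e\<close> with explicit complex scalar multiplications.
\<close>

locale anti_dual_pair =
  F: vector_space scaleF + E: vector_space scaleE
  for scaleF :: "complex \<Rightarrow> 'f::ab_group_add \<Rightarrow> 'f"
    and scaleE :: "complex \<Rightarrow> 'e::ab_group_add \<Rightarrow> 'e" +
  fixes pair :: "'f \<Rightarrow> 'e \<Rightarrow> complex"
  assumes pair_add_left: "pair (f + g) x = pair f x + pair g x"
    and pair_scale_left: "pair (scaleF c f) x = c * pair f x"
    and pair_add_right: "pair f (x + y) = pair f x + pair f y"
    and pair_scale_right: "pair f (scaleE c x) = cnj c * pair f x"
    and separates_E: "x \<noteq> y \<Longrightarrow> \<exists>f. pair f x \<noteq> pair f y"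
    and separates_F: "f \<noteq> g \<Longrightarrow> \<exists>x. pair f x \<noteq> pair g x"

definition weak_topology :: "('a \<Rightarrow> complex) set \<Rightarrow> 'a topology" where
  "weak_topology \<Phi> = topology_generated_by {\<phi> -` U |\<phi> U. \<phi> \<in> \<Phi> \<and> open U}"

text \<open>\<open>\<sigma>(F,E)\<close> and \<open>\<sigma>(E,F)\<close>, respectively.\<close>

definition sigma_F :: "('f \<Rightarrow> 'e \<Rightarrow> complex) \<Rightarrow> 'f topology" where
  "sigma_F pair = weak_topology (range (\<lambda>x f. pair f x))"

definition sigma_E :: "('f \<Rightarrow> 'e \<Rightarrow> complex) \<Rightarrow> 'e topology" where
  "sigma_E pair = weak_topology (range (\<lambda>f x. pair f x))"

text \<open>Cauchy with respect to the translation-invariant uniformity of a vector topology.\<close>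

definition Cauchy_seq_in :: "'a::ab_group_add topology \<Rightarrow> (nat \<Rightarrow> 'a) \<Rightarrow> bool" where
  "Cauchy_seq_in T s \<longleftrightarrow>
    (\<forall>U. openin T U \<and> 0 \<in> U \<longrightarrow> (\<exists>N. \<forall>m\<ge>N. \<forall>n\<ge>N. s m - s n \<in> U))"

definition weak_star_seq_complete :: "('f::ab_group_add \<Rightarrow> 'e \<Rightarrow> complex) \<Rightarrow> bool" where
  "weak_star_seq_complete pair \<longleftrightarrow>
    (\<forall>s. Cauchy_seq_in (sigma_F pair) s \<longrightarrow> (\<exists>f. limitin (sigma_F pair) s f sequentially))"

definition weakly_continuous_operators ::
  "(complex \<Rightarrow> 'f::ab_group_add \<Rightarrow> 'f) \<Rightarrow> (complex \<Rightarrow> 'e::ab_group_add \<Rightarrow> 'e) \<Rightarrow>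
    ('f \<Rightarrow> 'e \<Rightarrow> complex) \<Rightarrow> ('e \<Rightarrow> 'f) set" where
  "weakly_continuous_operators scaleF scaleE pair =
    {A. Vector_Spaces.linear scaleE scaleF A \<and> continuous_map (sigma_E pair) (sigma_F pair) A}"

text \<open>
  The order on \<^typ>\<open>complex\<close> is that of \<open>HOL-Library.Complex_Order\<close>: \<open>0 \<le> z\<close> means that
  \<open>z\<close> is real and nonnegative.
\<close>

definition positive_operator :: "('f \<Rightarrow> 'e \<Rightarrow> complex) \<Rightarrow> ('e \<Rightarrow> 'f) \<Rightarrow> bool" where
  "positive_operator pair A \<longleftrightarrow> (\<forall>x. 0 \<le> pair (A x) x)"

definition absolutely_continuous_operator ::
  "('f \<Rightarrow> 'e::ab_group_add \<Rightarrow> complex) \<Rightarrow> ('e \<Rightarrow> 'f) \<Rightarrow> ('e \<Rightarrow> 'f) \<Rightarrow> bool" where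
  \<comment> \<open>the second operator is absolutely continuous with respect to the first\<close>
  "absolutely_continuous_operator pair A B \<longleftrightarrow>
    (\<forall>x :: nat \<Rightarrow> 'e.
      (\<lambda>n. pair (A (x n)) (x n)) \<longlonglongrightarrow> 0 \<and>
      ((\<lambda>(n, m). pair (B (x n - x m)) (x n - x m)) \<longlongrightarrow> 0) (sequentially \<times>\<^sub>F sequentially)
      \<longrightarrow> (\<lambda>n. pair (B (x n)) (x n)) \<longlonglongrightarrow> 0)"

end

theory Submission
  imports Defs
begin

text \<open>
  Write \<open>a(x,y) = \<langle>Ax,y\<rangle>\<close> and \<open>b(x,y) = \<langle>Bx,y\<rangle>\<close>.
  For (i) \<open>\<Longrightarrow>\<close> (ii), let \<open>z\<^sub>n\<close> be a near-minimiser of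
  \<open>G\<^sub>n(z) = n a(z,z) + b(z-y,z-y)\<close>. The infima of \<open>G\<^sub>n\<close> increase with \<open>n\<close> and are bounded by
  \<open>b(y,y)\<close>, so \<open>a(z\<^sub>n,z\<^sub>n) \<rightarrow> 0\<close>, and the parallelogram law makes \<open>(z\<^sub>n)\<close> Cauchy for \<open>b\<close>;
  hence \<open>b(z\<^sub>n,z\<^sub>n) \<rightarrow> 0\<close> by absolute continuity. The approximate Euler--Lagrange equation of
  \<open>z\<^sub>n\<close> says that \<open>b(\<cdot>,y)\<close> is close to \<open>a(\<cdot>,n z\<^sub>n) + b(\<cdot>,z\<^sub>n)\<close>, so \<open>y\<^sub>n = n z\<^sub>n\<close> works.
  This replaces the usual passage to the Hilbert space completion of \<open>a + b\<close>.
\<close>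

text \<open>For \<open>q > 0\<close> evaluate at the minimiser \<open>- g / q\<close>. For
  \<open>q = 0\<close> the polynomial is affine in \<open>t\<close>, and for
  \<open>g \<noteq> 0\<close> the witness \<open>- (p + 1) / (2 * g)\<close> would give it the value
  -1.\<close>

lemma discriminant_le:
  fixes g p q :: real
  assumes "\<And>t. 0 \<le> p + 2 * t * g + t\<^sup>2 * q" "0 \<le> q"
  shows "g\<^sup>2 \<le> p * q"
proof (cases "q = 0")
  case True
  have "g = 0"
  proof (rule ccontr)
    assume "g \<noteq> 0"
    then show False
      using assms(1)[of "- (p + 1) / (2 * g)"] True by (simp add: field_simps)
  qed
  then show ?thesis using True by simp
next
  case False
  then have q: "q > 0" using assms(2) by simp
  have "0 \<le> p - g\<^sup>2 / q"
    using assms(1)[of "- g / q"] q by (simp add: power2_eq_square field_simps)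
  then show ?thesis using q by (simp add: field_simps)
qed

section \<open>Positive semidefinite sesquilinear forms\<close>

locale psd_form = vector_space scale
  for scale :: "complex \<Rightarrow> 'e::ab_group_add \<Rightarrow> 'e" +
  fixes s :: "'e \<Rightarrow> 'e \<Rightarrow> complex"
  assumes add_left: "s (x + y) z = s x z + s y z"
    and scale_left: "s (scale c x) z = c * s x z"
    and add_right: "s x (y + z) = s x y + s x z"
    and scale_right: "s x (scale c y) = cnj c * s x y"
    and nonneg: "0 \<le> s x x"
begin

definition q :: "'e \<Rightarrow> real" where "q x = Re (s x x)"

lemma q_nonneg: "0 \<le> q x"
  using nonneg[of x] by (simp add: q_def less_eq_complex_def)

lemma diag_eq: "s x x = of_real (q x)"
  using nonneg[of x] by (simp add: q_def less_eq_complex_def complex_eq_iff)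

lemma minus_left: "s (- x) y = - s x y"
  using scale_left[of "-1" x y] by (simp add: scale_minus_left)

lemma minus_right: "s x (- y) = - s x y"
  using scale_right[of x "-1" y] by (simp add: scale_minus_left)

lemma diff_right: "s x (y - z) = s x y - s x z"
  using add_right[of x y "- z"] by (simp add: minus_right)

text \<open>Polarisation: the diagonal of \<open>s\<close> is real, so the imaginary part of the
  expansion vanishes at \<open>x + y\<close> and at \<open>x + \<i> y\<close>. The first gives the
  imaginary part of the claim, the second the real part.\<close>

lemma hermitian: "s y x = cnj (s x y)"
proof -
  have *: "s (x + y) (x + y) = s x x + s x y + s y x + s y y" for x y
    by (simp add: add_left add_right)
  have "Im (s x y) + Im (s y x) = 0"
    using arg_cong[OF *[of x y], of Im] by (simp add: diag_eq)
  moreover have "Re (s y x) = Re (s x y)"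
    using arg_cong[OF *[of x "scale \<i> y"], of Im] by (simp add: scale_left scale_right diag_eq)
  ultimately show ?thesis by (simp add: complex_eq_iff)
qed

lemma q_add: "q (x + y) = q x + 2 * Re (s x y) + q y"
  unfolding q_def using hermitian[of x y] by (simp add: add_left add_right)

lemma q_scale: "q (scale c x) = (norm c)\<^sup>2 * q x"
proof -
  have "s (scale c x) (scale c x) = (c * cnj c) * s x x"
    by (simp add: scale_left scale_right)
  then have "s (scale c x) (scale c x) = of_real ((norm c)\<^sup>2 * q x)"
    by (simp add: diag_eq complex_mult_cnj cmod_power2)
  then show ?thesis by (simp add: q_def)
qed

lemma q_minus: "q (- x) = q x"
  by (simp add: q_def minus_left minus_right)

lemma q_minus_commute: "q (x - y) = q (y - x)"
  using q_minus[of "x - y"] by simp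

lemma parallelogram: "q (x + y) + q (x - y) = 2 * q x + 2 * q y"
  using q_add[of x y] q_add[of x "- y"] by (simp add: minus_right q_minus)

text \<open>Rotating \<open>x\<close> by a phase makes \<open>L x\<close> real and nonnegative;
  scaling by real \<open>t\<close> then reduces the claim to a discriminant. With
  \<open>L = s _ y\<close> this yields Cauchy-Schwarz, and with \<open>p\<close> a minimisation
  error it yields the approximate Euler-Lagrange equation.\<close>

lemma linear_functional_bound:
  assumes L: "\<And>c x. L (scale c x) = c * L x"
    and ge: "\<And>x. 0 \<le> p + 2 * Re (L x) + q x"
  shows "(norm (L x))\<^sup>2 \<le> p * q x"
proof (rule discriminant_le)
  fix t :: real
  define c where "c = of_real t * cnj (sgn (L x))"
  have Lc: "L (scale c x) = of_real (t * norm (L x))"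
  proof -
    have "cnj (sgn (L x)) * L x = of_real (norm (L x))"
      by (cases "L x = 0")
        (simp_all add: sgn_eq complex_norm_square[symmetric] power2_eq_square mult.commute[of "cnj _"])
    then show ?thesis by (simp add: L c_def mult.assoc)
  qed
  \<comment> \<open>Equality fails at most when \<open>L x = 0\<close>, where
    \<open>c = 0\<close>.\<close>
  have "(norm c)\<^sup>2 * q x \<le> t\<^sup>2 * q x"
    by (intro mult_right_mono q_nonneg)
      (simp add: c_def norm_mult power_mult_distrib norm_sgn)
  then show "0 \<le> p + 2 * t * norm (L x) + t\<^sup>2 * q x"
    using ge[of "scale c x"] by (simp add: Lc q_scale)
qed (rule q_nonneg)

lemma Cauchy_Schwarz: "norm (s x y) \<le> sqrt (q x) * sqrt (q y)"
proof -
  have "0 \<le> q y + 2 * Re (s u y) + q u" for u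
    using q_nonneg[of "u + y"] by (simp add: q_add)
  then have "(norm (s x y))\<^sup>2 \<le> q y * q x"
    by (intro linear_functional_bound) (simp_all add: scale_left)
  then show ?thesis
    by (metis mult.commute real_le_rsqrt real_sqrt_mult)
qed

end

section \<open>Penalised minimisation for two forms\<close>

locale two_psd_forms = a: psd_form scale a + b: psd_form scale b
  for scale :: "complex \<Rightarrow> 'e::ab_group_add \<Rightarrow> 'e" and a b
begin

lemma psd_form_weighted_sum:
  assumes "0 \<le> t"
  shows "psd_form scale (\<lambda>x y. of_real t * a x y + b x y)"
proof unfold_locales
  show "0 \<le> of_real t * a x x + b x x" for x
    using assms a.q_nonneg[of x] b.q_nonneg[of x]
    by (simp add: a.diag_eq b.diag_eq less_eq_complex_def)
qed (simp_all add: a.add_left b.add_left a.add_right b.add_right a.scale_left b.scale_left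
      a.scale_right b.scale_right algebra_simps)

text \<open>Inserting \<open>x + z\<close> into \<open>min\<close> and expanding leaves the
  tolerance \<open>d\<close>, twice the real part of the linear term, and the quadratic form of
  \<open>t a + b\<close> at \<open>x\<close>. For \<open>d = 0\<close> the bound is the exact
  Euler-Lagrange equation.\<close>

lemma near_minimiser:
  assumes t: "0 \<le> t"
    and min: "\<And>x. t * a.q z + b.q (z - y) \<le> t * a.q x + b.q (x - y) + d"
  shows "norm (of_real t * a x z + b x (z - y)) \<le> sqrt (d * (t * a.q x + b.q x))"
proof -
  interpret S: psd_form scale "\<lambda>x y. of_real t * a x y + b x y"
    using t by (rule psd_form_weighted_sum)
  have Sq: "S.q x = t * a.q x + b.q x" for x
    by (simp add: S.q_def a.q_def b.q_def)
  have "(norm (of_real t * a x z + b x (z - y)))\<^sup>2 \<le> d * S.q x"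
  proof (rule S.linear_functional_bound)
    show "of_real t * a (scale c x) z + b (scale c x) (z - y)
        = c * (of_real t * a x z + b x (z - y))" for c x
      by (simp add: a.scale_left b.scale_left algebra_simps)
    show "0 \<le> d + 2 * Re (of_real t * a x z + b x (z - y)) + S.q x" for x
      using min[of "x + z"] a.q_add[of x z] b.q_add[of x "z - y"]
      unfolding Sq by (simp add: algebra_simps)
  qed
  then show ?thesis by (simp add: Sq real_le_rsqrt)
qed

text \<open>The functional is at least \<open>m\<close> at the midpoint \<open>h\<close> of
  \<open>z\<close> and \<open>w\<close>, and the parallelogram law turns this into control of
  \<open>z - w\<close>. Two points with values close to a common lower bound are therefore close for
  \<open>b\<close>.\<close>

lemma midpoint_bound:
  assumes t: "0 \<le> t" and m: "\<And>x. m \<le> t * a.q x + b.q (x - y)"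
  shows "b.q (z - w) \<le> 2 * (t * a.q z + b.q (z - y)) + 2 * (t * a.q w + b.q (w - y)) - 4 * m"
proof -
  define h where "h = scale (1/2) (z + w)"
  have "scale (1/2) (y + y) = y"
    using a.scale_left_distrib[of "1/2" "1/2" y] by (simp add: a.scale_right_distrib)
  then have "h - y = scale (1/2) ((z + w) - (y + y))"
    by (simp only: h_def a.scale_right_diff_distrib)
  also have "(z + w) - (y + y) = (z - y) + (w - y)" by simp
  finally have hy: "h - y = scale (1/2) ((z - y) + (w - y))" .
  have "4 * a.q h + a.q (z - w) = 2 * a.q z + 2 * a.q w"
    using a.parallelogram[of z w] by (simp add: h_def a.q_scale power2_eq_square norm_divide)
  then have "t * (4 * a.q h + a.q (z - w)) = t * (2 * a.q z + 2 * a.q w)" by simp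
  moreover have "4 * b.q (h - y) + b.q (z - w) = 2 * b.q (z - y) + 2 * b.q (w - y)"
    using b.parallelogram[of "z - y" "w - y"]
    by (simp add: hy b.q_scale power2_eq_square norm_divide)
  moreover have "0 \<le> t * a.q (z - w)" using t a.q_nonneg by simp
  ultimately show ?thesis using m[of h] by (simp add: algebra_simps)
qed

section \<open>Absolute continuity and uniform approximation\<close>

definition abs_cont :: bool where
  "abs_cont \<longleftrightarrow> (\<forall>x :: nat \<Rightarrow> 'e.
    (\<lambda>n. a.q (x n)) \<longlonglongrightarrow> 0 \<and>
    ((\<lambda>(n, m). b.q (x n - x m)) \<longlongrightarrow> 0) (sequentially \<times>\<^sub>F sequentially)
    \<longrightarrow> (\<lambda>n. b.q (x n)) \<longlonglongrightarrow> 0)"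

lemma approximation_if_abs_cont:
  assumes abs_cont
  obtains ys e where "e \<longlonglongrightarrow> 0"
    "\<And>n x. norm (a x (ys n) - b x y) \<le> e n * sqrt (a.q x + b.q x)"
proof -
  \<comment> \<open>The weight is \<open>Suc n\<close>, so that it is positive at index 0
    too.\<close>
  define G where "G n x = real (Suc n) * a.q x + b.q (x - y)" for n x
  define m where "m n = Inf (range (G n))" for n
  \<comment> \<open>The Euler-Lagrange error involves \<open>d n\<close> times the weight, so
    \<open>d n\<close> has to decay faster than \<open>1 / Suc n\<close>.\<close>
  define d where "d n = 1 / (real (Suc n))\<^sup>2" for n
  have G0: "0 \<le> G n x" for n x
    by (simp add: G_def a.q_nonneg b.q_nonneg)
  then have bdd: "bdd_below (range (G n))" for n
    by (intro bdd_belowI[of _ 0]) auto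
  have m_le: "m n \<le> G n x" for n x
    unfolding m_def by (rule cInf_lower) (simp_all add: bdd)
  have m_greatest: "c \<le> m n" if "\<And>x. c \<le> G n x" for c n
    unfolding m_def using that by (intro cInf_greatest) auto
  have d_pos: "0 < d n" for n by (simp add: d_def)
  have d_lim: "d \<longlonglongrightarrow> 0"
  proof -
    have "(\<lambda>n. (1 / real (Suc n))\<^sup>2) \<longlonglongrightarrow> 0\<^sup>2"
      by (intro tendsto_power LIMSEQ_Suc lim_1_over_n)
    then show ?thesis by (simp add: d_def[abs_def] power_divide)
  qed
  have "\<exists>z. G n z < m n + d n" for n
    using cInf_lessD[of "range (G n)" "m n + d n"] d_pos[of n] by (auto simp: m_def)
  then obtain z where z: "\<And>n. G n (z n) < m n + d n" by metis
  have G_mono: "G k x \<le> G n x" if "k \<le> n" for k n x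
    using that by (auto simp: G_def intro!: mult_right_mono a.q_nonneg)
  have m_mono: "m k \<le> m n" if "k \<le> n" for k n
    using m_le G_mono[OF that] by (intro m_greatest) (meson order_trans)
  \<comment> \<open>The competitor 0 has the value \<open>b.q y\<close> for every weight.\<close>
  have m_bound: "m n \<le> b.q y" for n
  proof -
    have "a.q 0 = 0" using a.q_scale[of 0 0] by simp
    then show ?thesis using m_le[of n 0] by (simp add: G_def b.q_minus)
  qed
  have "convergent m"
    by (intro Bseq_mono_convergent BseqI'[of _ "b.q y"])
      (use m_mono m_bound m_greatest[OF G0] in auto)
  then obtain l where l: "m \<longlonglongrightarrow> l" by (auto simp: convergent_def)
  have a_bound: "a.q (z n) \<le> (b.q y + 1) * (1 / real (Suc n))" for n
  proof -
    have "d n \<le> 1" by (simp add: d_def)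
    then have "real (Suc n) * a.q (z n) \<le> b.q y + 1"
      using z[of n] m_bound[of n] b.q_nonneg[of "z n - y"] by (simp add: G_def)
    then show ?thesis by (simp add: field_simps)
  qed
  have a_lim: "(\<lambda>n. a.q (z n)) \<longlonglongrightarrow> 0"
  proof (rule tendsto_sandwich[OF _ _ tendsto_const])
    have "(\<lambda>n. (b.q y + 1) * (1 / real (Suc n))) \<longlonglongrightarrow> (b.q y + 1) * 0"
      by (intro tendsto_intros LIMSEQ_Suc lim_1_over_n)
    then show "(\<lambda>n. (b.q y + 1) * (1 / real (Suc n))) \<longlonglongrightarrow> 0" by simp
  qed (simp_all only: a_bound a.q_nonneg eventually_True)
  \<comment> \<open>The absolute value makes \<open>h\<close> symmetric, so the bound proved for
    \<open>k \<le> n\<close> extends to all pairs.\<close>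
  define h where "h p = 2 * \<bar>m (snd p) - m (fst p)\<bar> + 2 * d (fst p) + 2 * d (snd p)" for p
  have le: "b.q (z k - z n) \<le> h (k, n)" if "k \<le> n" for k n
  proof -
    \<comment> \<open>Both points are tested in the functional with the smaller weight:
      \<open>G k (z n) \<le> G n (z n) < m n + d n\<close>.\<close>
    have "b.q (z k - z n) \<le> 2 * G k (z k) + 2 * G k (z n) - 4 * m k"
      unfolding G_def by (rule midpoint_bound) (use m_le in \<open>simp_all add: G_def\<close>)
    then show ?thesis
      using G_mono[OF that, of "z n"] z[of k] z[of n] abs_ge_self[of "m n - m k"]
      unfolding h_def fst_conv snd_conv by argo
  qed
  have b_bound: "b.q (z k - z n) \<le> h (k, n)" for k n
  proof (cases "k \<le> n")
    case False
    then have "b.q (z n - z k) \<le> h (n, k)" by (intro le) simp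
    then show ?thesis using b.q_minus_commute[of "z k"] by (simp add: h_def abs_minus_commute)
  qed (rule le)
  have "((\<lambda>p. b.q (z (fst p) - z (snd p))) \<longlongrightarrow> 0) (sequentially \<times>\<^sub>F sequentially)"
  proof (rule tendsto_sandwich[OF _ _ tendsto_const])
    have "(h \<longlongrightarrow> 2 * \<bar>l - l\<bar> + 2 * 0 + 2 * 0) (sequentially \<times>\<^sub>F sequentially)"
      unfolding h_def
      by (intro tendsto_intros filterlim_compose[OF l] filterlim_compose[OF d_lim]
          filterlim_fst filterlim_snd)
    then show "(h \<longlongrightarrow> 0) (sequentially \<times>\<^sub>F sequentially)" by simp
  qed (use b_bound[of "fst p" "snd p" for p] in \<open>simp_all add: b.q_nonneg always_eventually\<close>)
  then have b_lim: "(\<lambda>n. b.q (z n)) \<longlonglongrightarrow> 0"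
    using assms a_lim unfolding abs_cont_def case_prod_unfold by blast
  \<comment> \<open>The first summand is the Euler-Lagrange error, the second comes from
    Cauchy-Schwarz applied to \<open>b x (z n)\<close>.\<close>
  define e where "e n = sqrt (1 / real (Suc n)) + sqrt (b.q (z n))" for n
  show ?thesis
  proof (rule that)
    have "e \<longlonglongrightarrow> sqrt 0 + sqrt 0"
      unfolding e_def by (intro tendsto_intros LIMSEQ_Suc[OF lim_1_over_n] b_lim)
    then show "e \<longlonglongrightarrow> 0" by simp
    fix n x
    let ?y = "scale (of_nat (Suc n)) (z n)" and ?c = "a.q x + b.q x"
    have c: "0 \<le> ?c" by (simp add: a.q_nonneg b.q_nonneg)
    have "norm (of_real (real (Suc n)) * a x (z n) + b x (z n - y))
        \<le> sqrt (d n * (real (Suc n) * a.q x + b.q x))"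
    proof (rule near_minimiser)
      show "real (Suc n) * a.q (z n) + b.q (z n - y)
          \<le> real (Suc n) * a.q x + b.q (x - y) + d n" for x
        using z[of n] m_le[of n x] by (simp add: G_def)
    qed simp
    \<comment> \<open>Enlarging the \<open>b\<close> term lets the weight factor out; it then
      cancels one factor of \<open>d n\<close>.\<close>
    also have "\<dots> \<le> sqrt (d n * (real (Suc n) * ?c))"
    proof -
      have "b.q x \<le> real (Suc n) * b.q x"
        using mult_right_mono[of 1 "real (Suc n)" "b.q x"] b.q_nonneg by simp
      then show ?thesis
        using d_pos[of n] by (intro real_sqrt_le_mono mult_left_mono) (simp_all add: distrib_left)
    qed
    also have "d n * (real (Suc n) * ?c) = 1 / real (Suc n) * ?c"
      by (simp add: d_def power2_eq_square del: of_nat_Suc)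
    finally have "norm (of_real (real (Suc n)) * a x (z n) + b x (z n - y))
        \<le> sqrt (1 / real (Suc n)) * sqrt ?c" unfolding real_sqrt_mult .
    moreover have "norm (b x (z n)) \<le> sqrt (b.q (z n)) * sqrt ?c"
    proof -
      have "norm (b x (z n)) \<le> sqrt (b.q x) * sqrt (b.q (z n))" by (rule b.Cauchy_Schwarz)
      also have "\<dots> \<le> sqrt ?c * sqrt (b.q (z n))"
        by (intro mult_right_mono) (simp_all add: a.q_nonneg b.q_nonneg)
      finally show ?thesis by (simp add: mult.commute)
    qed
    moreover have "a x ?y - b x y
        = (of_real (real (Suc n)) * a x (z n) + b x (z n - y)) - b x (z n)"
      by (simp add: a.scale_right b.diff_right)
    ultimately show "norm (a x ?y - b x y) \<le> e n * sqrt ?c"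
      unfolding e_def distrib_right by (simp only:) (rule order_trans[OF norm_triangle_ineq4 add_mono])
  qed
qed

text \<open>The sequence \<open>x n\<close> is eventually bounded for \<open>a + b\<close>, so
  uniform approximation of \<open>b _ y\<close> by functionals \<open>a _ (ys k)\<close>, which
  vanish along it in the limit, gives \<open>b (x n) y \<longlonglongrightarrow> 0\<close> for each
  \<open>y\<close>. A \<open>b\<close>-Cauchy sequence that is null in this weak sense is null for
  \<open>b.q\<close>.\<close>

lemma abs_cont_if_approximation:
  assumes "\<And>y. \<exists>ys. uniform_limit {x. a.q x + b.q x \<le> 1} (\<lambda>n x. a x (ys n)) (\<lambda>x. b x y) sequentially"
  shows abs_cont
  unfolding abs_cont_def
proof (intro allI impI, elim conjE)
  fix x :: "nat \<Rightarrow> 'e"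
  assume a0: "(\<lambda>n. a.q (x n)) \<longlonglongrightarrow> 0"
  assume "((\<lambda>(n, m). b.q (x n - x m)) \<longlongrightarrow> 0) (sequentially \<times>\<^sub>F sequentially)"
  then have "\<forall>\<^sub>F p in sequentially \<times>\<^sub>F sequentially. b.q (x (fst p) - x (snd p)) < d" if "0 < d" for d
    using that unfolding case_prod_unfold by (rule order_tendstoD(2))
  then have cauchy: "\<exists>N. \<forall>m\<ge>N. \<forall>n\<ge>N. b.q (x n - x m) < d" if "0 < d" for d
    using that unfolding eventually_prod_sequentially by fastforce
  obtain N where N: "\<And>m n. m \<ge> N \<Longrightarrow> n \<ge> N \<Longrightarrow> b.q (x n - x m) < 1"
    using cauchy[of 1] by auto
  \<comment> \<open>For large \<open>n\<close>, \<open>b.q (x n)\<close> is at most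
    \<open>2 * b.q (x N) + 2\<close> by the parallelogram law, and \<open>a.q (x n)\<close> adds at
    most 1.\<close>
  define M where "M = 2 * b.q (x N) + 3"
  have M: "0 < M" using b.q_nonneg[of "x N"] by (simp add: M_def)
  have "\<forall>\<^sub>F n in sequentially. a.q (x n) < 1" using a0 by (rule order_tendstoD) simp
  then have bounded: "\<forall>\<^sub>F n in sequentially. a.q (x n) + b.q (x n) \<le> M"
    using eventually_ge_at_top[of N]
  proof eventually_elim
    case (elim n)
    have "b.q (x n) \<le> 2 * b.q (x n - x N) + 2 * b.q (x N)"
      using b.parallelogram[of "x n - x N" "x N"] b.q_nonneg[of "x n - x N - x N"] by simp
    then show ?case using elim N[of N n] by (simp add: M_def)
  qed
  have weak: "(\<lambda>n. b (x n) y) \<longlonglongrightarrow> 0" for y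
  proof (rule tendstoI)
    fix d :: real assume d: "0 < d"
    obtain ys where ul: "uniform_limit {x. a.q x + b.q x \<le> 1} (\<lambda>n x. a x (ys n)) (\<lambda>x. b x y) sequentially"
      using assms by blast
    \<comment> \<open>Division by \<open>sqrt M\<close> moves \<open>x n\<close> into the set of
      uniform convergence; scaling back turns this tolerance into \<open>d / 2\<close>.\<close>
    have "0 < d / 2 / sqrt M" using d M by simp
    from eventually_happens[OF uniform_limitD[OF ul this]]
    obtain k where k: "\<And>u. a.q u + b.q u \<le> 1 \<Longrightarrow> dist (a u (ys k)) (b u y) < d / 2 / sqrt M" by auto
    have "(\<lambda>n. sqrt (a.q (x n)) * sqrt (a.q (ys k))) \<longlonglongrightarrow> sqrt 0 * sqrt (a.q (ys k))"
      by (intro tendsto_intros a0)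
    then have "\<forall>\<^sub>F n in sequentially. sqrt (a.q (x n)) * sqrt (a.q (ys k)) < d / 2"
      by (rule order_tendstoD) (use d in simp)
    with bounded show "\<forall>\<^sub>F n in sequentially. dist (b (x n) y) 0 < d"
    proof eventually_elim
      case (elim n)
      define r :: complex where "r = of_real (1 / sqrt M)"
      have r: "norm r = 1 / sqrt M" using M by (simp add: r_def norm_divide)
      have "a.q (scale r (x n)) + b.q (scale r (x n)) = (a.q (x n) + b.q (x n)) / M"
        using M by (simp add: a.q_scale b.q_scale r power_divide add_divide_distrib)
      also have "\<dots> \<le> 1" using elim M by simp
      finally have "norm (r * (a (x n) (ys k) - b (x n) y)) < d / 2 / sqrt M"
        using k[of "scale r (x n)"]
        by (simp add: a.scale_left b.scale_left dist_norm right_diff_distrib)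
      then have 1: "norm (a (x n) (ys k) - b (x n) y) < d / 2"
        using M by (simp only: norm_mult r) (simp add: field_simps)
      have 2: "norm (a (x n) (ys k)) < d / 2"
        using a.Cauchy_Schwarz[of "x n" "ys k"] elim by simp
      have "norm (b (x n) y) \<le> norm (a (x n) (ys k)) + norm (a (x n) (ys k) - b (x n) y)"
        by (metis diff_diff_eq2 add_diff_cancel_left' norm_triangle_ineq4)
      with 1 2 show ?case by simp
    qed
  qed
  show "(\<lambda>n. b.q (x n)) \<longlonglongrightarrow> 0"
  proof (rule tendstoI)
    fix d :: real assume d: "0 < d"
    \<comment> \<open>Freezing the second argument at \<open>x K\<close> splits
      \<open>b.q (x n)\<close> into \<open>b (x n) (x n - x K)\<close>, at most
      \<open>sqrt M * sqrt w = d / 2\<close>, and \<open>b (x n) (x K)\<close>, small by weak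
      convergence.\<close>
    define w where "w = (d / 2 / sqrt M)\<^sup>2"
    have w: "0 < w" "sqrt M * sqrt w = d / 2" using d M by (simp_all add: w_def)
    obtain K where K: "\<And>m n. m \<ge> K \<Longrightarrow> n \<ge> K \<Longrightarrow> b.q (x n - x m) < w"
      using cauchy[OF w(1)] by auto
    have "\<forall>\<^sub>F n in sequentially. norm (b (x n) (x K)) < d / 2"
      using tendstoD[OF weak[of "x K"], of "d / 2"] d by simp
    with bounded eventually_ge_at_top[of K]
    show "\<forall>\<^sub>F n in sequentially. dist (b.q (x n)) 0 < d"
    proof eventually_elim
      case (elim n)
      have "norm (b (x n) (x n - x K)) \<le> sqrt (b.q (x n)) * sqrt (b.q (x n - x K))"
        by (rule b.Cauchy_Schwarz)
      also have "\<dots> \<le> sqrt M * sqrt w"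
        using elim K[of K n] a.q_nonneg[of "x n"] M b.q_nonneg
        by (intro mult_mono real_sqrt_le_mono) (simp_all add: less_imp_le)
      finally have "norm (b (x n) (x n - x K)) \<le> d / 2" by (simp add: w)
      moreover have "b.q (x n) = norm (b (x n) (x n - x K) + b (x n) (x K))"
        by (simp add: b.diff_right b.diag_eq b.q_nonneg)
      ultimately show ?case
        using elim norm_triangle_ineq[of "b (x n) (x n - x K)" "b (x n) (x K)"] b.q_nonneg[of "x n"]
        by simp
    qed
  qed
qed

text \<open>The error bound \<open>e n * sqrt (a.q x + b.q x)\<close> gives both modes of
  convergence: the root is constant for fixed \<open>x\<close> and at most 1 on the given
  set.\<close>

theorem abs_cont_iff_approximation:
  "abs_cont \<longleftrightarrow> (\<forall>y. \<exists>ys.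
    (\<forall>x. (\<lambda>n. a x (ys n)) \<longlonglongrightarrow> b x y) \<and>
    uniform_limit {x. a.q x + b.q x \<le> 1} (\<lambda>n x. a x (ys n)) (\<lambda>x. b x y) sequentially)"
proof
  assume abs_cont
  show "\<forall>y. \<exists>ys. (\<forall>x. (\<lambda>n. a x (ys n)) \<longlonglongrightarrow> b x y) \<and>
    uniform_limit {x. a.q x + b.q x \<le> 1} (\<lambda>n x. a x (ys n)) (\<lambda>x. b x y) sequentially"
  proof
    fix y
    obtain ys e where e: "e \<longlonglongrightarrow> 0"
      and le: "\<And>n x. norm (a x (ys n) - b x y) \<le> e n * sqrt (a.q x + b.q x)"
      using approximation_if_abs_cont[OF \<open>abs_cont\<close>] by blast
    have "(\<lambda>n. a x (ys n)) \<longlonglongrightarrow> b x y" for x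
    proof -
      have "(\<lambda>n. e n * sqrt (a.q x + b.q x)) \<longlonglongrightarrow> 0"
        using e by (rule tendsto_mult_left_zero)
      then have "(\<lambda>n. a x (ys n) - b x y) \<longlonglongrightarrow> 0"
        by (rule Lim_null_comparison[rotated]) (simp add: le)
      then show ?thesis by (simp add: LIM_zero_iff)
    qed
    moreover have "uniform_limit {x. a.q x + b.q x \<le> 1} (\<lambda>n x. a x (ys n)) (\<lambda>x. b x y) sequentially"
    proof (rule uniform_limitI)
      fix d :: real assume "0 < d"
      then have "\<forall>\<^sub>F n in sequentially. \<bar>e n\<bar> < d"
        using tendstoD[OF e] by simp
      then show "\<forall>\<^sub>F n in sequentially. \<forall>x\<in>{x. a.q x + b.q x \<le> 1}. dist (a x (ys n)) (b x y) < d"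
      proof (rule eventually_mono, intro ballI)
        fix n x assume n: "\<bar>e n\<bar> < d" and "x \<in> {x. a.q x + b.q x \<le> 1}"
        then have "sqrt (a.q x + b.q x) \<le> 1" by simp
        then have "\<bar>e n\<bar> * sqrt (a.q x + b.q x) \<le> \<bar>e n\<bar>"
          by (rule mult_left_le) simp
        moreover have "e n * sqrt (a.q x + b.q x) \<le> \<bar>e n\<bar> * sqrt (a.q x + b.q x)"
          by (intro mult_right_mono) (simp_all add: a.q_nonneg b.q_nonneg)
        ultimately show "dist (a x (ys n)) (b x y) < d"
          using le[of x n] n by (simp add: dist_norm)
      qed
    qed
    ultimately show "\<exists>ys. (\<forall>x. (\<lambda>n. a x (ys n)) \<longlonglongrightarrow> b x y) \<and>
      uniform_limit {x. a.q x + b.q x \<le> 1} (\<lambda>n x. a x (ys n)) (\<lambda>x. b x y) sequentially"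
      by blast
  qed
qed (rule abs_cont_if_approximation, blast)

end

section \<open>Transfer to positive operators\<close>

lemma psd_form_of_positive_operator:
  assumes "anti_dual_pair scaleF scaleE pair" "Vector_Spaces.linear scaleE scaleF A"
    and "positive_operator pair A"
  shows "psd_form scaleE (\<lambda>x y. pair (A x) y)"
proof -
  interpret anti_dual_pair scaleF scaleE pair by fact
  interpret A: Vector_Spaces.linear scaleE scaleF A by fact
  show ?thesis
    by unfold_locales
      (use assms(3) in \<open>simp_all add: A.add A.scale pair_add_left pair_add_right pair_scale_left
        pair_scale_right positive_operator_def\<close>)
qed

theorem theorem5p3:
  fixes scaleF :: "complex \<Rightarrow> 'f::ab_group_add \<Rightarrow> 'f"
    and scaleE :: "complex \<Rightarrow> 'e::ab_group_add \<Rightarrow> 'e"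
    and pair :: "'f \<Rightarrow> 'e \<Rightarrow> complex"
    and A B :: "'e \<Rightarrow> 'f"
  assumes "anti_dual_pair scaleF scaleE pair"
    and "weak_star_seq_complete pair"
    and "A \<in> weakly_continuous_operators scaleF scaleE pair"
    and "B \<in> weakly_continuous_operators scaleF scaleE pair"
    and "positive_operator pair A"
    and "positive_operator pair B"
  shows "absolutely_continuous_operator pair A B \<longleftrightarrow>
    (\<forall>y. \<exists>ys :: nat \<Rightarrow> 'e.
      (\<forall>x. (\<lambda>n. pair (A x) (ys n)) \<longlonglongrightarrow> pair (B x) y) \<and>
      uniform_limit {x. pair (A x + B x) x \<le> 1}
        (\<lambda>n x. pair (A x) (ys n)) (\<lambda>x. pair (B x) y) sequentially)"
proof -
  interpret two_psd_forms scaleE "\<lambda>x y. pair (A x) y" "\<lambda>x y. pair (B x) y"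
    using assms unfolding weakly_continuous_operators_def
    by (intro two_psd_forms.intro psd_form_of_positive_operator) auto
  have "absolutely_continuous_operator pair A B \<longleftrightarrow> abs_cont"
    unfolding absolutely_continuous_operator_def abs_cont_def a.diag_eq b.diag_eq case_prod_unfold
    by (simp only: tendsto_of_real_iff of_real_0[symmetric, where 'a = complex])
  \<comment> \<open>In the order on \<open>complex\<close>, \<open>z \<le> 1\<close> also requires
    \<open>z\<close> to be real, which diagonal values of positive operators are.\<close>
  moreover have "{x. pair (A x + B x) x \<le> 1} = {x. a.q x + b.q x \<le> 1}"
    using anti_dual_pair.pair_add_left[OF assms(1)]
    by (simp add: a.diag_eq b.diag_eq less_eq_complex_def)
  ultimately show ?thesis
    using abs_cont_iff_approximation by simp
qed

end
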